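(* For every integer $m \geq 2$ and every integer $n \geq m$, there exists a positive integral frieze of type $A_n$ containing $m$ as an entry; likewise there exists a positive integral frieze of type $B_n$ containing $m$ as an entry, one of type $C_n$ containing $m$ as an entry, and (when $n \geq 4$, so that type $D_n$ is defined) one of type $D_n$ containing $m$ as an entry. Consequently, the set of all values appearing as entries of positive integral Dynkin friezes (over all finite Dynkin types) is exactly the set $\mathbb{N}$ of positive integers.
   Context: $\mathbb{N}$ denotes the set of positive integers. Let $\Delta_n$ be a finite Dynkin type of rank $n$ with generalized Cartan matrix $C = (c_{i,j})_{1 \leq i,j \leq n}$. A positive integral (Dynkin) frieze of type $\Delta_n$ is an array of positive integers $(x_{i,j})_{1 \leq i \leq n,\, j \in \mathbb{Z}}$ satisfying $$x_{i,j}\, x_{i,j+1} - \prod_{k<i} x_{k,j+1}^{|c_{k,i}|} \prod_{k>i} x_{k,j}^{|c_{k,i}|} = 1$$ for all $i \in \{1,\ldots,n\}$ and $j \in \mathbb{Z}$ (empty products equal $1$). The entries of the frieze are the integers $x_{i,j}$. Cartan matrices of the classical types, in the labeling used here (all diagonal entries are $2$ and all off-diagonal entries not listed are $0$): - Type $A_n$ ($n\ge 1$): $c_{i,i+1} = c_{i+1,i} = -1$ for $1 \le i \le n-1$. - Type $B_n$ ($n \geq 2$): $c_{1,2} = -2$, $c_{2,1} = -1$, and $c_{i,i+1} = c_{i+1,i} = -1$ for $2 \le i \le n-1$. - Type $C_n$ ($n \geq 2$): the transpose of type $B_n$, i.e. $c_{1,2} = -1$, $c_{2,1} = -2$, and $c_{i,i+1}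 = c_{i+1,i} = -1$ for $2 \le i \le n-1$. - Type $D_n$ ($n \geq 4$): $c_{1,3} = c_{3,1} = -1$, $c_{2,3} = c_{3,2} = -1$, and $c_{i,i+1} = c_{i+1,i} = -1$ for $3 \le i \le n-1$. The remaining finite Dynkin types are the exceptional types $E_6, E_7, E_8, F_4, G_2$ with their standard Cartan matrices. *)

theory Defs
  imports Main
begin

text \<open>
  Matrices and arrays are total functions indexed from 1; only the indices
  \<open>1, \<dots>, n\<close> (with \<open>n\<close> the rank) are ever used.
\<close>

definition cartan_A :: "nat \<Rightarrow> nat \<Rightarrow> int" where
  "cartan_A i j = (if i = j then 2 else if j = i + 1 \<or> i = j + 1 then -1 else 0)"

definition cartan_B :: "nat \<Rightarrow> nat \<Rightarrow> int" where
  "cartan_B i j = (if i = 1 \<and> j = 2 then -2 else cartan_A i j)"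

definition cartan_C :: "nat \<Rightarrow> nat \<Rightarrow> int" where
  "cartan_C i j = cartan_B j i"

definition cartan_D :: "nat \<Rightarrow> nat \<Rightarrow> int" where
  "cartan_D i j =
    (if i = j then 2
     else if (i, j) \<in> {(1, 3), (3, 1), (2, 3), (3, 2)} then -1
     else if i \<ge> 3 \<and> j \<ge> 3 \<and> (j = i + 1 \<or> i = j + 1) then -1
     else 0)"

text \<open>
  The exceptional matrices are those of Bourbaki's plates. In type \<open>E\<close> the nodes
  1, 3, 4, 5, \<dots> form a chain and node 2 is attached to node 4. Types \<open>F\<^sub>4\<close> and
  \<open>G\<^sub>2\<close> are isomorphic to their transposes, by reversing the order of the nodes.
\<close>

definition cartan_E :: "nat \<Rightarrow> nat \<Rightarrow> int" where
  "cartan_E i j =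
    (if i = j then 2
     else if (i, j) \<in> {(1, 3), (3, 1), (2, 4), (4, 2)} then -1
     else if i \<ge> 3 \<and> j \<ge> 3 \<and> (j = i + 1 \<or> i = j + 1) then -1
     else 0)"

definition cartan_F4 :: "nat \<Rightarrow> nat \<Rightarrow> int" where
  "cartan_F4 i j = (if i = 2 \<and> j = 3 then -2 else cartan_A i j)"

definition cartan_G2 :: "nat \<Rightarrow> nat \<Rightarrow> int" where
  "cartan_G2 i j = (if i = 2 \<and> j = 1 then -3 else cartan_A i j)"

datatype dynkin = An nat | Bn nat | Cn nat | Dn nat | E6 | E7 | E8 | F4 | G2

fun valid_dynkin :: "dynkin \<Rightarrow> bool" where
  "valid_dynkin (An n) \<longleftrightarrow> n \<ge> 1"
| "valid_dynkin (Bn n) \<longleftrightarrow> n \<ge> 2"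
| "valid_dynkin (Cn n) \<longleftrightarrow> n \<ge> 2"
| "valid_dynkin (Dn n) \<longleftrightarrow> n \<ge> 4"
| "valid_dynkin E6 \<longleftrightarrow> True"
| "valid_dynkin E7 \<longleftrightarrow> True"
| "valid_dynkin E8 \<longleftrightarrow> True"
| "valid_dynkin F4 \<longleftrightarrow> True"
| "valid_dynkin G2 \<longleftrightarrow> True"

fun dynkin_rank :: "dynkin \<Rightarrow> nat" where
  "dynkin_rank (An n) = n"
| "dynkin_rank (Bn n) = n"
| "dynkin_rank (Cn n) = n"
| "dynkin_rank (Dn n) = n"
| "dynkin_rank E6 = 6"
| "dynkin_rank E7 = 7"
| "dynkin_rank E8 = 8"
| "dynkin_rank F4 = 4"
| "dynkin_rank G2 = 2"

fun dynkin_cartan :: "dynkin \<Rightarrow> nat \<Rightarrow> nat \<Rightarrow> int" where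
  "dynkin_cartan (An n) = cartan_A"
| "dynkin_cartan (Bn n) = cartan_B"
| "dynkin_cartan (Cn n) = cartan_C"
| "dynkin_cartan (Dn n) = cartan_D"
| "dynkin_cartan E6 = cartan_E"
| "dynkin_cartan E7 = cartan_E"
| "dynkin_cartan E8 = cartan_E"
| "dynkin_cartan F4 = cartan_F4"
| "dynkin_cartan G2 = cartan_G2"

definition positive_integral_frieze :: "dynkin \<Rightarrow> (nat \<Rightarrow> int \<Rightarrow> int) \<Rightarrow> bool" where
  "positive_integral_frieze T x \<longleftrightarrow>
    (let n = dynkin_rank T; c = dynkin_cartan T in
      \<forall>i\<in>{1..n}. \<forall>j.
        x i j > 0 \<and>
        x i j * x i (j + 1)
          - (\<Prod>k\<in>{1..<i}. x k (j + 1) ^ nat \<bar>c k i\<bar>) * (\<Prod>k\<in>{i<..n}. x k j ^ nat \<bar>c k i\<bar>) = 1)"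

definition frieze_entries :: "dynkin \<Rightarrow> (nat \<Rightarrow> int \<Rightarrow> int) \<Rightarrow> int set" where
  "frieze_entries T x = {x i j | i j. i \<in> {1..dynkin_rank T}}"

end

theory Submission
  imports Defs
begin

text \<open>
  For a sequence of vectors \<open>v\<^sub>a \<in> \<int>\<^sup>2\<close> with \<open>det (v\<^sub>a, v\<^sub>a\<^sub>+\<^sub>1) = 1\<close>, the numbers
  \<open>\<lambda> (a, b) = det (v\<^sub>a, v\<^sub>b)\<close> are integers, and the three-term Pluecker relation gives
  \<open>\<lambda> (a, b) \<lambda> (a+1, b+1) = 1 + \<lambda> (a+1, b) \<lambda> (a, b+1)\<close>. This is the frieze relation
  at every node whose neighbours are joined to it by simple edges. The Dynkin type is decided by
  what happens at the ends of the chain of nodes, and there everything is controlled by a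
  monodromy \<open>M \<in> SL\<^sub>2(\<int>)\<close> with \<open>v\<^sub>a\<^sub>+\<^sub>P = M v\<^sub>a\<close>:

  \<^item> \<open>M = -1\<close> forces \<open>\<lambda> (a, a+P-1) = 1\<close>, so the array closes up after \<open>P - 3\<close> rows: type \<open>A\<close>,
    with the \<open>\<lambda> (a, b)\<close> in the role of lengths of diagonals of a triangulated \<open>P\<close>-gon.
  \<^item> If \<open>M\<close> is the rotation by a right angle, \<open>\<lambda> (a, b+P) = \<lambda> (b, a+P)\<close>, so at the row of
    the \<open>\<lambda> (a, a+P)\<close> the product of the two neighbours becomes a square: type \<open>C\<close>, realised
    by centrally symmetric \<open>2P\<close>-gons.
  \<^item> If \<open>M\<close> is the shear \<open>(x, y) \<mapsto> (x, y+x)\<close>, then \<open>\<lambda> (a, a+P)\<close> is the square of the first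
    coordinate of \<open>v\<^sub>a\<close>; replacing that row by its square root yields type \<open>B\<close>, realised by
    \<open>P\<close>-gons with a puncture, the first coordinates being the lengths of the arcs to the puncture.

  In all three cases one and the same period of vectors works,
  \<open>(1, 0), (K-1, 1), (K-2, 1), \<dots>, (K-P+1, 1)\<close>, corresponding to a fan triangulation. The
  determinant of \<open>(K-r, 1)\<close> and \<open>(K-s, 1)\<close> is \<open>s - r\<close>, and the coordinates themselves run
  through an interval of integers, so every value in the required range occurs. Lemma
  \<open>twisted_fan\<close> extends the period along \<open>M\<close> and reduces positivity to a check inside
  one period. Type \<open>D\<close> is settled by an explicit frieze, constant on each row outside the fork.

  Entries are positive by definition, so the last claim follows from type \<open>A\<close>, where rank \<open>n\<close>
  already gives all values from \<open>1\<close> to \<open>n + 1\<close>.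
\<close>

section \<open>Twisted-periodic fans of lattice vectors\<close>

definition wedge :: "int \<times> int \<Rightarrow> int \<times> int \<Rightarrow> int" where
  "wedge p q = fst p * snd q - snd p * fst q"

lemma pluecker:
  "wedge a b * wedge c d = wedge a c * wedge b d + wedge a d * wedge c b"
  by (simp add: wedge_def algebra_simps)

lemma periodic_mod:
  fixes f :: "int \<Rightarrow> 'a" and P :: int
  assumes per: "\<And>a. f (a + P) = f a"
  shows "f a = f (a mod P)"
proof -
  have nat_shift: "f (b + int k * P) = f b" for b k
  proof (induction k)
    case (Suc k)
    have "f (b + int (Suc k) * P) = f ((b + int k * P) + P)"
      by (simp add: algebra_simps)
    then show ?case using per Suc.IH by simp
  qed simp
  show ?thesis
  proof (cases "a div P \<ge> 0")
    case True
    have "a = a mod P + int (nat (a div P)) * P" using True by simp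
    then show ?thesis using nat_shift by metis
  next
    case False
    then have "a mod P = a + int (nat (- (a div P))) * P"
      by (simp add: minus_div_mult_eq_mod [symmetric])
    then show ?thesis using nat_shift by metis
  qed
qed

text \<open>
  A bijection acts through all integer powers, so any choice of one period extends in both
  directions to a sequence with monodromy \<open>M\<close>.
\<close>

lemma twisted_extension_exists:
  fixes u :: "int \<Rightarrow> 'a" and P :: int
  assumes "bij M" "P > 0"
  obtains v where "\<And>a. v (a + P) = M (v a)" "\<And>r. 0 \<le> r \<Longrightarrow> r < P \<Longrightarrow> v r = u r"
proof
  define it where "it q = (if q \<ge> 0 then M ^^ nat q else inv M ^^ nat (- q))" for q :: int
  define v where "v a = it (a div P) (u (a mod P))" for a
  have it_step: "it (q + 1) p = M (it q p)" for q p
  proof (cases "q \<ge> 0")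
    case True
    then show ?thesis by (simp add: it_def nat_add_distrib)
  next
    case False
    define k where "k = nat (- q - 1)"
    have k: "nat (- q) = Suc k" "q + 1 = - int k" using False by (auto simp: k_def)
    have "it (q + 1) = inv M ^^ k" using k(2) by (cases "k = 0") (auto simp: it_def)
    moreover have "it q = inv M ^^ Suc k" using k False by (simp add: it_def)
    ultimately show ?thesis
      using \<open>bij M\<close> by (simp add: bij_is_surj surj_f_inv_f)
  qed
  show "v (a + P) = M (v a)" for a
    using \<open>P > 0\<close> it_step[of "a div P" "u (a mod P)"]
    by (simp add: v_def div_add_self2)
  show "v r = u r" if "0 \<le> r" "r < P" for r
    using that by (simp add: v_def it_def)
qed

text \<open>
  Only the values at \<open>0 \<le> r < P\<close> for a period \<open>P\<close> matter. The vector at \<open>0\<close> is the apex of the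
  fan: it has determinant \<open>1\<close> with all the others.
\<close>

definition fan :: "int \<Rightarrow> int \<Rightarrow> int \<times> int" where
  "fan K r = (if r = 0 then (1, 0) else (K - r, 1))"

lemma wedge_fan:
  assumes "0 \<le> r" "r < s"
  shows "wedge (fan K r) (fan K s) = (if r = 0 then 1 else s - r)"
  using assms by (simp add: wedge_def fan_def)

text \<open>
  Since \<open>M\<close> preserves determinants, \<open>wedge (v a) (v (a + d))\<close> is \<open>P\<close>-periodic in \<open>a\<close>. Hence
  properties of pairs at distance less than \<open>P\<close> need only be verified when the first index lies
  in \<open>{0..<P}\<close>; the second then lies in the same period, where the fan decides, or in the next
  one, which is what \<open>seam\<close> and \<open>pos\<close> are about.
\<close>

lemma twisted_fan:
  fixes K P :: int and M :: "int \<times> int \<Rightarrow> int \<times> int"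
  assumes M: "bij M" "\<And>p q. wedge (M p) (M q) = wedge p q"
    and P: "P \<ge> 2"
    and seam: "wedge (K - (P - 1), 1) (M (1, 0)) = 1"
    and pos: "\<And>r s. 0 \<le> s \<Longrightarrow> s < r \<Longrightarrow> r < P \<Longrightarrow> wedge (fan K r) (M (fan K s)) > 0"
  obtains v where "\<And>a. v (a + P) = M (v a)"
    and "\<And>r. 0 \<le> r \<Longrightarrow> r < P \<Longrightarrow> v r = fan K r"
    and "\<And>a. wedge (v a) (v (a + 1)) = 1"
    and "\<And>a b. a < b \<Longrightarrow> b < a + P \<Longrightarrow> wedge (v a) (v b) > 0"
proof -
  obtain v where v: "\<And>a. v (a + P) = M (v a)" "\<And>r. 0 \<le> r \<Longrightarrow> r < P \<Longrightarrow> v r = fan K r"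
    using twisted_extension_exists[OF M(1), of P "fan K"] P by auto
  have red: "wedge (v a) (v (a + d)) = wedge (v (a mod P)) (v (a mod P + d))" for a d
  proof (rule periodic_mod[where f = "\<lambda>a. wedge (v a) (v (a + d))"])
    show "wedge (v (a + P)) (v (a + P + d)) = wedge (v a) (v (a + d))" for a
      using v(1)[of a] v(1)[of "a + d"] M(2) by (simp add: ac_simps)
  qed
  have range: "0 \<le> a mod P" "a mod P < P" for a using P by auto
  show ?thesis
  proof (rule that[of v])
    fix a
    show "wedge (v a) (v (a + 1)) = 1"
    proof (cases "a mod P + 1 < P")
      case True
      then show ?thesis using red[of a 1] v(2) range[of a] wedge_fan[of "a mod P" "a mod P + 1" K]
        by simp
    next
      case False
      then have last: "a mod P = P - 1" using range(2)[of a] by simp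
      have "wedge (v a) (v (a + 1)) = wedge (v (P - 1)) (v (0 + P))"
        using red[of a 1] last by simp
      also have "\<dots> = wedge (fan K (P - 1)) (M (fan K 0))"
        using v(1)[of 0] v(2)[of 0] v(2)[of "P - 1"] P by simp
      finally show ?thesis using seam P by (simp add: fan_def)
    qed
  next
    fix a b :: int
    assume ab: "a < b" "b < a + P"
    define r d where "r = a mod P" and "d = b - a"
    have rd: "0 \<le> r" "r < P" "0 < d" "d < P" using ab range by (auto simp: r_def d_def)
    have eq: "wedge (v a) (v b) = wedge (v r) (v (r + d))"
      using red[of a d] by (simp add: r_def d_def)
    show "wedge (v a) (v b) > 0"
    proof (cases "r + d < P")
      case True
      then show ?thesis using eq rd v(2) wedge_fan[of r "r + d" K] by simp
    next
      case False
      then show ?thesis using eq rd v(1)[of "r + d - P"] v(2) pos[of "r + d - P" r] by simp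
    qed
  qed (use v in auto)
qed

section \<open>The frieze relation along a chain\<close>

lemma prod_only:
  assumes "finite S" "\<And>k. k \<in> S \<Longrightarrow> k \<noteq> k0 \<Longrightarrow> f k = 1"
  shows "prod f S = (if k0 \<in> S then f k0 else (1::'a::comm_monoid_mult))"
proof -
  have "prod f S = prod (\<lambda>k. if k = k0 then f k else 1) S"
    using assms(2) by (intro prod.cong) auto
  then show ?thesis using assms(1) by (simp add: prod.delta')
qed

text \<open>
  When node \<open>i\<close> is joined at most to \<open>i - 1\<close> and \<open>i + 1\<close>, each product has at most one factor
  different from \<open>1\<close>. A fictitious row \<open>n + 1\<close> filled with \<open>1\<close> removes the case distinction
  at the end of the chain; at its beginning the formulas that define
  the arrays of types \<open>B\<close> and \<open>C\<close> do not produce such a row.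
\<close>

lemma frieze_relation_chain:
  fixes c :: "nat \<Rightarrow> nat \<Rightarrow> int" and x :: "nat \<Rightarrow> int \<Rightarrow> int"
  assumes i: "1 \<le> i" "i \<le> n"
    and lower: "\<And>k. k \<ge> 1 \<Longrightarrow> k + 1 < i \<Longrightarrow> c k i = 0"
    and upper: "\<And>k. i + 1 < k \<Longrightarrow> k \<le> n \<Longrightarrow> c k i = 0"
    and boundary: "\<And>j. x (n + 1) j = 1"
    and rel: "x i j * x i (j + 1) = 1 +
      (if i = 1 then 1 else x (i - 1) (j + 1) ^ nat \<bar>c (i - 1) i\<bar>) * x (i + 1) j ^ nat \<bar>c (i + 1) i\<bar>"
  shows "x i j * x i (j + 1)
    - (\<Prod>k\<in>{1..<i}. x k (j + 1) ^ nat \<bar>c k i\<bar>) * (\<Prod>k\<in>{i<..n}. x k j ^ nat \<bar>c k i\<bar>) = 1"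
proof -
  have "(\<Prod>k\<in>{1..<i}. x k (j + 1) ^ nat \<bar>c k i\<bar>) =
      (if i - 1 \<in> {1..<i} then x (i - 1) (j + 1) ^ nat \<bar>c (i - 1) i\<bar> else 1)"
    by (rule prod_only) (auto simp: lower)
  also have "\<dots> = (if i = 1 then 1 else x (i - 1) (j + 1) ^ nat \<bar>c (i - 1) i\<bar>)"
    using i by auto
  finally have left: "(\<Prod>k\<in>{1..<i}. x k (j + 1) ^ nat \<bar>c k i\<bar>) = \<dots>" .
  have "(\<Prod>k\<in>{i<..n}. x k j ^ nat \<bar>c k i\<bar>) =
      (if i + 1 \<in> {i<..n} then x (i + 1) j ^ nat \<bar>c (i + 1) i\<bar> else 1)"
    by (rule prod_only) (auto simp: upper)
  also have "\<dots> = x (i + 1) j ^ nat \<bar>c (i + 1) i\<bar>"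
    using i boundary[of j] by (cases "i = n") auto
  finally have right: "(\<Prod>k\<in>{i<..n}. x k j ^ nat \<bar>c k i\<bar>) = \<dots>" .
  show ?thesis unfolding left right rel by simp
qed

lemma frieze_entriesI:
  assumes "x i j = k" "i \<in> {1..dynkin_rank T}"
  shows "k \<in> frieze_entries T x"
  using assms unfolding frieze_entries_def by blast

section \<open>Type A: fan triangulations of a polygon\<close>

text \<open>
  The vectors form a closed polygon up to sign, with \<open>P = n + 3\<close> vertices, and row \<open>i\<close> holds the
  diagonals that skip \<open>i\<close> vertices; rows \<open>0\<close> and \<open>n + 1\<close> are the sides of the polygon. The parameter of
  the fan is arbitrary here, because \<open>(K-P+1, 1)\<close> and \<open>M (1, 0) = (-1, 0)\<close> have
  determinant \<open>1\<close> for every \<open>K\<close>.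
\<close>

lemma frieze_A:
  assumes n: "n \<ge> 1"
  shows "\<exists>x. positive_integral_frieze (An n) x \<and> {1..int n + 1} \<subseteq> frieze_entries (An n) x"
proof -
  define M where "M = (\<lambda>(x, y). (- x, - y) :: int \<times> int)"
  define P where "P = int n + 3"
  have wM: "wedge p (M q) = wedge q p" for p q
    by (simp add: wedge_def M_def split: prod.splits)
  have M: "bij M"
    by (rule o_bij[of M]) (auto simp: M_def)
  obtain v where v: "\<And>a. v (a + P) = M (v a)"
      "\<And>r. 0 \<le> r \<Longrightarrow> r < P \<Longrightarrow> v r = fan P r"
      "\<And>a. wedge (v a) (v (a + 1)) = 1"
      "\<And>a b. a < b \<Longrightarrow> b < a + P \<Longrightarrow> wedge (v a) (v b) > 0"
  proof (rule twisted_fan[of M P P])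
    show "wedge (M p) (M q) = wedge p q" for p q
      by (simp add: wedge_def M_def split: prod.splits)
    show "wedge (P - (P - 1), 1) (M (1, 0)) = 1" by (simp add: wedge_def M_def)
    show "0 < wedge (fan P r) (M (fan P s))" if "0 \<le> s" "s < r" for r s
      using wedge_fan[OF that] that by (simp add: wM)
  qed (auto simp: M P_def)
  define x where "x i j = wedge (v j) (v (j + int i + 1))" for i j
  have x_0: "x 0 j = 1" for j by (simp add: x_def v(3))
  have x_last: "x (n + 1) j = 1" for j
  proof -
    have "x (n + 1) j = wedge (v j) (v (j - 1 + P))" by (simp add: x_def P_def algebra_simps)
    also have "\<dots> = wedge (v (j - 1)) (v (j - 1 + 1))" by (simp only: v(1) wM) simp
    finally show ?thesis by (simp only: v(3))
  qed
  have rel: "x i j * x i (j + 1) = 1 + x (i - 1) (j + 1) * x (i + 1) j" if "i \<ge> 1" for i j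
  proof -
    have "int (i - 1) = int i - 1" using that by simp
    then show ?thesis
      using pluecker[of "v j" "v (j + int i + 1)" "v (j + 1)" "v (j + int i + 1 + 1)"]
        v(3)[of j] v(3)[of "j + int i + 1"]
      by (simp add: x_def algebra_simps)
  qed
  have "positive_integral_frieze (An n) x"
    unfolding positive_integral_frieze_def Let_def dynkin_rank.simps dynkin_cartan.simps
  proof (intro ballI allI conjI)
    fix i j assume i: "i \<in> {1..n}"
    show "x i j > 0" using i by (auto simp: x_def P_def intro!: v(4))
    show "x i j * x i (j + 1)
      - (\<Prod>k\<in>{1..<i}. x k (j + 1) ^ nat \<bar>cartan_A k i\<bar>)
        * (\<Prod>k\<in>{i<..n}. x k j ^ nat \<bar>cartan_A k i\<bar>) = 1"
      using i rel[of i j] x_0 x_last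
      by (intro frieze_relation_chain) (auto simp: cartan_A_def)
  qed
  moreover have "k \<in> frieze_entries (An n) x" if k: "k \<in> {1..int n + 1}" for k
  proof (cases "k = 1")
    case True
    have "x 1 0 = 1" using v(2)[of 0] v(2)[of 2] wedge_fan[of 0 2 P] by (simp add: x_def P_def)
    then show ?thesis using True n by (intro frieze_entriesI) auto
  next
    case False
    then have "x (nat (k - 1)) 1 = k" "nat (k - 1) \<in> {1..n}"
      using k v(2)[of 1] v(2)[of "k + 1"] wedge_fan[of 1 "k + 1" P] by (auto simp: x_def P_def)
    then show ?thesis by (intro frieze_entriesI) simp_all
  qed
  ultimately show ?thesis by blast
qed

section \<open>Type B: fans around a puncture\<close>

text \<open>
  Here \<open>P = n + 1\<close>, and the last vector of the fan must be \<open>(2, 1)\<close> to have determinant \<open>1\<close> with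
  \<open>M (1, 0) = (1, 1)\<close>, which fixes \<open>K = P + 1\<close>. The slopes \<open>0, 1/(n+1), \<dots>, 1/2\<close> then increase by
  \<open>1\<close> over each period, whence positivity. The values \<open>2, \<dots>, n+1\<close> are the first coordinates
  of the fan and thus all occur in row \<open>1\<close>. The rows \<open>i \<ge> 2\<close> hold the \<open>\<lambda> (a, b)\<close> with
  \<open>b - a = n + 2 - i\<close>, so that the side of the polygon is the fictitious row \<open>n + 1\<close>.
\<close>

lemma frieze_B:
  assumes n: "n \<ge> 2"
  shows "\<exists>x. positive_integral_frieze (Bn n) x \<and> {2..int n + 1} \<subseteq> frieze_entries (Bn n) x"
proof -
  define M where "M = (\<lambda>(x, y). (x, y + x) :: int \<times> int)"
  define P where "P = int n + 1"
  have wM: "wedge p (M q) = wedge p q + fst p * fst q" for p q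
    by (simp add: wedge_def M_def algebra_simps split: prod.splits)
  have M: "bij M"
    by (rule o_bij[of "\<lambda>(x, y). (x, y - x)"]) (auto simp: M_def)
  obtain v where v: "\<And>a. v (a + P) = M (v a)"
      "\<And>r. 0 \<le> r \<Longrightarrow> r < P \<Longrightarrow> v r = fan (P + 1) r"
      "\<And>a. wedge (v a) (v (a + 1)) = 1"
      "\<And>a b. a < b \<Longrightarrow> b < a + P \<Longrightarrow> wedge (v a) (v b) > 0"
  proof (rule twisted_fan[of M P "P + 1"])
    show "wedge (M p) (M q) = wedge p q" for p q
      by (simp add: wedge_def M_def algebra_simps split: prod.splits)
    show "wedge (P + 1 - (P - 1), 1) (M (1, 0)) = 1" by (simp add: wedge_def M_def)
    show "0 < wedge (fan (P + 1) r) (M (fan (P + 1) s))" if "0 \<le> s" "s < r" "r < P" for r s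
    proof (cases "s = 0")
      case True
      then show ?thesis using that by (simp add: wM) (simp add: wedge_def fan_def)
    next
      case False
      \<comment> \<open>Because \<open>r < P\<close>, the first coordinate \<open>P + 1 - r\<close> is at least \<open>2\<close>.\<close>
      have "r - s < 2 * (P + 1 - s)" using that by arith
      also have "\<dots> \<le> (P + 1 - r) * (P + 1 - s)"
        using that by (intro mult_right_mono) auto
      finally have "r - s < (P + 1 - r) * (P + 1 - s)" .
      then show ?thesis using that False by (simp add: wM) (simp add: wedge_def fan_def)
    qed
  qed (use n in \<open>auto simp: M P_def\<close>)
  have fst_pos: "fst (v a) > 0" for a
  proof -
    have "fst (v a) = fst (v (a mod P))"
      by (rule periodic_mod) (simp add: v(1) M_def split: prod.splits)
    moreover have "P > 0" by (simp add: P_def)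
    then have "0 \<le> a mod P" "a mod P < P" by simp_all
    ultimately show ?thesis using v(2) by (simp add: fan_def)
  qed
  define x where
    "x i j = (if i = 1 then fst (v (j + 1)) else wedge (v (j + int i)) (v (j + int n + 2)))" for i j
  have x_last: "x (n + 1) j = 1" for j
    using v(3)[of "j + int n + 1"] n by (simp add: x_def algebra_simps)
  \<comment> \<open>The shear adds to a determinant the product of the first coordinates, that is, of two radii.\<close>
  have rel1: "x 1 j * x 1 (j + 1) = 1 + x 2 j" for j
  proof -
    have "v (j + int n + 2) = M (v (j + 1))" using v(1)[of "j + 1"] by (simp add: P_def ac_simps)
    moreover have "wedge (v (j + 2)) (v (j + 1)) = - 1"
      using v(3)[of "j + 1"] by (simp add: wedge_def algebra_simps)
    ultimately show ?thesis by (simp add: x_def wM algebra_simps)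
  qed
  have rel: "x i j * x i (j + 1) = 1 +
      wedge (v (j + int i)) (v (j + int n + 3)) * x (i + 1) j" if "i \<ge> 2" for i j
    using pluecker[of "v (j + int i)" "v (j + int n + 2)" "v (j + int i + 1)" "v (j + int n + 2 + 1)"]
      v(3)[of "j + int i"] v(3)[of "j + int n + 2"] that
    by (simp add: x_def algebra_simps)
  have rel2: "x 2 j * x 2 (j + 1) = 1 + x 1 (j + 1) ^ 2 * x 3 j" for j
  proof -
    have "v (j + int n + 3) = M (v (j + 2))" using v(1)[of "j + 2"] by (simp add: P_def ac_simps)
    then have "wedge (v (j + 2)) (v (j + int n + 3)) = fst (v (j + 2)) ^ 2"
      by (simp add: wM) (simp add: wedge_def power2_eq_square)
    then show ?thesis using rel[of 2 j] by (simp add: x_def ac_simps)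
  qed
  have rel3: "x i j * x i (j + 1) = 1 + x (i - 1) (j + 1) * x (i + 1) j" if "i \<ge> 3" for i j
  proof -
    have "int (i - 1) = int i - 1" "i - 1 \<noteq> 1" using that by auto
    then show ?thesis using rel[of i j] that by (simp add: x_def algebra_simps)
  qed
  have "positive_integral_frieze (Bn n) x"
    unfolding positive_integral_frieze_def Let_def dynkin_rank.simps dynkin_cartan.simps
  proof (intro ballI allI conjI)
    fix i j assume i: "i \<in> {1..n}"
    show "x i j > 0" using i fst_pos by (auto simp: x_def P_def intro!: v(4))
    consider "i = 1" | "i = 2" | "i \<ge> 3" using i by fastforce
    then have "x i j * x i (j + 1) = 1 +
      (if i = 1 then 1 else x (i - 1) (j + 1) ^ nat \<bar>cartan_B (i - 1) i\<bar>)
        * x (i + 1) j ^ nat \<bar>cartan_B (i + 1) i\<bar>"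
    proof cases
      case 1 then show ?thesis using rel1 by (simp add: cartan_A_def cartan_B_def numeral_2_eq_2)
    next
      case 2 then show ?thesis using rel2 by (simp add: cartan_A_def cartan_B_def)
    next
      case 3 then show ?thesis using rel3 by (auto simp add: cartan_A_def cartan_B_def)
    qed
    then show "x i j * x i (j + 1)
      - (\<Prod>k\<in>{1..<i}. x k (j + 1) ^ nat \<bar>cartan_B k i\<bar>)
        * (\<Prod>k\<in>{i<..n}. x k j ^ nat \<bar>cartan_B k i\<bar>) = 1"
      using i x_last
      by (intro frieze_relation_chain) (auto simp: cartan_A_def cartan_B_def)
  qed
  moreover have "k \<in> frieze_entries (Bn n) x" if k: "k \<in> {2..int n + 1}" for k
  proof -
    have "x 1 (int n + 1 - k) = k" using k v(2)[of "int n + 2 - k"]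
      by (simp add: x_def P_def fan_def algebra_simps)
    then show ?thesis using n by (intro frieze_entriesI) auto
  qed
  ultimately show ?thesis by blast
qed

section \<open>Type C: centrally symmetric fans\<close>

text \<open>
  Row \<open>1\<close> now holds \<open>\<lambda> (a, a+P)\<close>, with \<open>P = n + 1\<close>, which is the squared Euclidean length of
  \<open>v\<^sub>a\<close>; in the centrally symmetric \<open>2P\<close>-gon these are the diameters. The fan has to end in
  \<open>(1, 1)\<close>, next to \<open>M (1, 0) = (0, 1)\<close>, so \<open>K = P\<close>. The determinant of
  \<open>(k, 1)\<close> with \<open>M (1, 0)\<close> is \<open>k\<close>, which provides the entries.
\<close>

lemma frieze_C:
  assumes n: "n \<ge> 2"
  shows "\<exists>x. positive_integral_frieze (Cn n) x \<and> {2..int n} \<subseteq> frieze_entries (Cn n) x"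
proof -
  define M where "M = (\<lambda>(x, y). (- y, x) :: int \<times> int)"
  define P where "P = int n + 1"
  have wM: "wedge p (M q) = fst p * fst q + snd p * snd q" for p q
    by (simp add: wedge_def M_def split: prod.splits)
  have M: "bij M"
    by (rule o_bij[of "\<lambda>(x, y). (y, - x)"]) (auto simp: M_def)
  obtain v where v: "\<And>a. v (a + P) = M (v a)"
      "\<And>r. 0 \<le> r \<Longrightarrow> r < P \<Longrightarrow> v r = fan P r"
      "\<And>a. wedge (v a) (v (a + 1)) = 1"
      "\<And>a b. a < b \<Longrightarrow> b < a + P \<Longrightarrow> wedge (v a) (v b) > 0"
  proof (rule twisted_fan[of M P P])
    show "wedge (M p) (M q) = wedge p q" for p q
      by (simp add: wedge_def M_def algebra_simps split: prod.splits)
    show "wedge (P - (P - 1), 1) (M (1, 0)) = 1" by (simp add: wedge_def M_def)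
    show "0 < wedge (fan P r) (M (fan P s))" if "0 \<le> s" "s < r" "r < P" for r s
      using that by (auto simp: wM fan_def intro!: add_pos_pos mult_pos_pos)
  qed (use n in \<open>auto simp: M P_def\<close>)
  define x where "x i j = wedge (v (j + int i)) (v (j + int n + 2))" for i j
  have x_last: "x (n + 1) j = 1" for j
    using v(3)[of "j + int n + 1"] n by (simp add: x_def algebra_simps)
  have rel: "x i j * x i (j + 1) = 1 +
      wedge (v (j + int i)) (v (j + int n + 3)) * x (i + 1) j" for i j
    using pluecker[of "v (j + int i)" "v (j + int n + 2)" "v (j + int i + 1)" "v (j + int n + 2 + 1)"]
      v(3)[of "j + int i"] v(3)[of "j + int n + 2"]
    by (simp add: x_def algebra_simps)
  have rel1: "x 1 j * x 1 (j + 1) = 1 + x 2 j ^ 2" for j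
  proof -
    have "v (j + int n + 3) = M (v (j + 2))" "v (j + int n + 2) = M (v (j + 1))"
      using v(1)[of "j + 2"] v(1)[of "j + 1"] by (simp_all add: P_def ac_simps)
    \<comment> \<open>Both sides are the inner product of \<open>v (j + 1)\<close> and \<open>v (j + 2)\<close>.\<close>
    then have "wedge (v (j + 1)) (v (j + int n + 3)) = x 2 j"
      by (simp add: x_def wM)
    then show ?thesis using rel[of 1 j] by (simp add: power2_eq_square numeral_2_eq_2)
  qed
  have rel2: "x i j * x i (j + 1) = 1 + x (i - 1) (j + 1) * x (i + 1) j" if "i \<ge> 2" for i j
  proof -
    have "int (i - 1) = int i - 1" using that by simp
    then show ?thesis using rel[of i j] by (simp add: x_def algebra_simps)
  qed
  have "x 1 j > 0" for j
  proof -
    have "v (j + int n + 2) = M (v (j + 1))"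
      using v(1)[of "j + 1"] by (simp add: P_def ac_simps)
    moreover have "fst (v (j + 1)) \<noteq> 0 \<or> snd (v (j + 1)) \<noteq> 0"
      using v(3)[of "j + 1"] by (auto simp: wedge_def)
    ultimately show ?thesis
      by (simp add: x_def wM) (simp add: sum_squares_gt_zero_iff)
  qed
  moreover have "x i j > 0" if "2 \<le> i" "i \<le> n" for i j
    using that by (auto simp: x_def P_def intro!: v(4))
  ultimately have pos: "x i j > 0" if "1 \<le> i" "i \<le> n" for i j
    using that by (cases "i = 1") auto
  have "positive_integral_frieze (Cn n) x"
    unfolding positive_integral_frieze_def Let_def dynkin_rank.simps dynkin_cartan.simps
  proof (intro ballI allI conjI)
    fix i j assume i: "i \<in> {1..n}"
    show "x i j > 0" using i pos by simp
    have "x i j * x i (j + 1) = 1 +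
      (if i = 1 then 1 else x (i - 1) (j + 1) ^ nat \<bar>cartan_C (i - 1) i\<bar>)
        * x (i + 1) j ^ nat \<bar>cartan_C (i + 1) i\<bar>"
    proof (cases "i = 1")
      case True
      then show ?thesis using rel1
        by (simp add: cartan_A_def cartan_B_def cartan_C_def numeral_2_eq_2)
    next
      case False
      then show ?thesis using rel2[of i j] i
        by (auto simp: cartan_A_def cartan_B_def cartan_C_def)
    qed
    then show "x i j * x i (j + 1)
      - (\<Prod>k\<in>{1..<i}. x k (j + 1) ^ nat \<bar>cartan_C k i\<bar>)
        * (\<Prod>k\<in>{i<..n}. x k j ^ nat \<bar>cartan_C k i\<bar>) = 1"
      using i x_last
      by (intro frieze_relation_chain) (auto simp: cartan_A_def cartan_B_def cartan_C_def)
  qed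
  moreover have "k \<in> frieze_entries (Cn n) x" if k: "k \<in> {2..int n}" for k
  proof -
    have "x (nat (int n + 2 - k)) (- 1) = k" "nat (int n + 2 - k) \<in> {1..n}"
      using k v(2)[of "int n + 1 - k"] v(1)[of 0] v(2)[of 0]
      by (auto simp: x_def P_def fan_def M_def wedge_def algebra_simps)
    then show ?thesis by (intro frieze_entriesI) simp_all
  qed
  ultimately show ?thesis by blast
qed

section \<open>Type D: all arcs at the puncture\<close>

text \<open>
  On the long arm the rows are the constants \<open>n-1, n-2, \<dots>, 2\<close>, followed by a fictitious \<open>1\<close>: the
  relation becomes \<open>k\<^sup>2 = 1 + (k-1) (k+1)\<close>. At the branch node the two fork entries
  must then multiply to \<open>n\<close>, and they do so if one of them is \<open>1\<close> and the other \<open>n\<close>, with the roles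
  exchanged at every step, since \<open>1 \<cdot> n = 1 + (n-1)\<close> is what the fork nodes require.
  Geometrically, the polygon with \<open>n\<close> sides around a puncture is triangulated by the \<open>n\<close> plain
  radii; these have length \<open>1\<close>, the notched ones length \<open>n\<close>.
\<close>

lemma frieze_D:
  assumes n: "n \<ge> 4"
  shows "\<exists>x. positive_integral_frieze (Dn n) x \<and> {2..int n} \<subseteq> frieze_entries (Dn n) x"
proof -
  define x :: "nat \<Rightarrow> int \<Rightarrow> int" where
    "x i j = (if i = 1 then (if even j then 1 else int n)
              else if i = 2 then (if even j then int n else 1)
              else int n + 2 - int i)" for i j
  have "positive_integral_frieze (Dn n) x"
    unfolding positive_integral_frieze_def Let_def dynkin_rank.simps dynkin_cartan.simps
  proof (intro ballI allI conjI)
    fix i j assume i: "i \<in> {1..n}"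
    show "x i j > 0" using i n by (auto simp: x_def)
    have "(\<Prod>k\<in>{i<..n}. x k j ^ nat \<bar>cartan_D k i\<bar>) =
        (if i \<le> 2 then x 3 j else x (i + 1) j)"
    proof -
      define k0 where "k0 = (if i \<le> 2 then 3 else i + 1)"
      have "(\<Prod>k\<in>{i<..n}. x k j ^ nat \<bar>cartan_D k i\<bar>) =
          (if k0 \<in> {i<..n} then x k0 j ^ nat \<bar>cartan_D k0 i\<bar> else 1)"
        using i by (intro prod_only) (auto simp: cartan_D_def k0_def)
      then show ?thesis using i n by (auto simp: k0_def cartan_D_def x_def)
    qed
    moreover have "(\<Prod>k\<in>{1..<i}. x k (j + 1) ^ nat \<bar>cartan_D k i\<bar>) =
        (if i \<le> 2 then 1 else if i = 3 then int n else x (i - 1) (j + 1))"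
    proof -
      consider "i = 1" | "i = 2" | "i = 3" | "i \<ge> 4" using i by fastforce
      then show ?thesis
      proof cases
        case 3
        have "{1..<3::nat} = {1, 2}" by auto
        then show ?thesis using 3 by (simp add: cartan_D_def x_def)
      next
        case 4
        have "(\<Prod>k\<in>{1..<i}. x k (j + 1) ^ nat \<bar>cartan_D k i\<bar>) =
            (if i - 1 \<in> {1..<i} then x (i - 1) (j + 1) ^ nat \<bar>cartan_D (i - 1) i\<bar> else 1)"
          using 4 by (intro prod_only) (auto simp: cartan_D_def)
        then show ?thesis using 4 by (auto simp: cartan_D_def)
      qed (auto simp: cartan_D_def numeral_2_eq_2)
    qed
    ultimately show "x i j * x i (j + 1)
      - (\<Prod>k\<in>{1..<i}. x k (j + 1) ^ nat \<bar>cartan_D k i\<bar>)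
        * (\<Prod>k\<in>{i<..n}. x k j ^ nat \<bar>cartan_D k i\<bar>) = 1"
      using i by (auto simp: x_def algebra_simps)
  qed
  moreover have "k \<in> frieze_entries (Dn n) x" if k: "k \<in> {2..int n}" for k
  proof (cases "k = int n")
    case True
    have "x 1 1 = int n" by (simp add: x_def)
    then show ?thesis using True n by (intro frieze_entriesI) auto
  next
    case False
    then have "x (nat (int n + 2 - k)) 0 = k" "nat (int n + 2 - k) \<in> {1..n}"
      using k by (auto simp: x_def)
    then show ?thesis by (intro frieze_entriesI) simp_all
  qed
  ultimately show ?thesis by blast
qed

section \<open>All entries of Dynkin friezes\<close>

theorem theorem1:
  shows "(\<forall>m n :: nat. m \<ge> 2 \<and> n \<ge> m \<longrightarrow>
            (\<exists>x. positive_integral_frieze (An n) x \<and> int m \<in> frieze_entries (An n) x) \<and>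
            (\<exists>x. positive_integral_frieze (Bn n) x \<and> int m \<in> frieze_entries (Bn n) x) \<and>
            (\<exists>x. positive_integral_frieze (Cn n) x \<and> int m \<in> frieze_entries (Cn n) x) \<and>
            (n \<ge> 4 \<longrightarrow>
              (\<exists>x. positive_integral_frieze (Dn n) x \<and> int m \<in> frieze_entries (Dn n) x))) \<and>
         {v. \<exists>T x. valid_dynkin T \<and> positive_integral_frieze T x \<and> v \<in> frieze_entries T x}
           = {v :: int. v > 0}"
proof (intro conjI allI impI; (elim conjE)?)
  fix m n :: nat
  assume mn: "m \<ge> 2" "n \<ge> m"
  show "\<exists>x. positive_integral_frieze (An n) x \<and> int m \<in> frieze_entries (An n) x"
    using frieze_A[of n] mn by fastforce
  show "\<exists>x. positive_integral_frieze (Bn n) x \<and> int m \<in> frieze_entries (Bn n) x"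
    using frieze_B[of n] mn by fastforce
  show "\<exists>x. positive_integral_frieze (Cn n) x \<and> int m \<in> frieze_entries (Cn n) x"
    using frieze_C[of n] mn by fastforce
  show "\<exists>x. positive_integral_frieze (Dn n) x \<and> int m \<in> frieze_entries (Dn n) x" if "n \<ge> 4"
    using frieze_D[of n] mn that by fastforce
next
  show "{v. \<exists>T x. valid_dynkin T \<and> positive_integral_frieze T x \<and> v \<in> frieze_entries T x}
      = {v :: int. v > 0}"
  proof (intro set_eqI iffI; unfold mem_Collect_eq)
    fix k :: int
    assume "\<exists>T x. valid_dynkin T \<and> positive_integral_frieze T x \<and> k \<in> frieze_entries T x"
    then show "k > 0"
      by (auto simp: positive_integral_frieze_def frieze_entries_def Let_def)
  next
    fix k :: int
    assume "k > 0"
    then have "nat k \<ge> 1" "k \<in> {1..int (nat k) + 1}" by auto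
    then obtain x where "positive_integral_frieze (An (nat k)) x" "k \<in> frieze_entries (An (nat k)) x"
      using frieze_A[of "nat k"] by blast
    moreover have "valid_dynkin (An (nat k))" using \<open>k > 0\<close> by simp
    ultimately show "\<exists>T x. valid_dynkin T \<and> positive_integral_frieze T x \<and> k \<in> frieze_entries T x"
      by blast
  qed
qed

end
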